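(* Under the independent cascade model with myopic feedback, the adaptivity gap of the influence maximization problem is at least $e/(e-1)$; that is, $$\sup_{G,k}\frac{\mathrm{OPT}_A(G,k)}{\mathrm{OPT}_N(G,k)}\ge \frac{e}{e-1},$$ where the supremum is over all influence graphs $G$ and all seed budgets $k\ge 1$.
   Context: Influence graph: $G=(V,E,p)$, where $V$ is a finite nonempty set of nodes, $E\subseteq V\times V$ is a set of directed edges, and each edge $(u,v)\in E$ carries a probability $p_{uv}\in[0,1]$. Independent cascade (IC) model: a random live-edge graph is obtained by declaring each edge $(u,v)\in E$ live independently with probability $p_{uv}$, and blocked otherwise. A realization $\phi$ specifies the status (live or blocked) of every edge; it is identified with the corresponding live-edge graph. $\mathcal P$ denotes the distribution of the random realization $\Phi$. For $S\subseteq V$, $\Gamma(S,\phi)$ is the set of nodes reachable in $\phi$ from nodes of $S$ (including $S$ itself), $f(S,\phi)=|\Gamma(S,\phi)|$, and $\sigma(S)=\mathbb E_{\Phi\sim\mathcal P}[f(S,\Phi)]$ is the influence spread of $S$. Myopic feedback: when $u$ is selected as a seed under realization $\phi$, the feedback $\phi(u)$ revealed is the live/blocked status of the out-going edges of $u$, and nothing else. A partial realization $\psi$ assigns to each node of a set $\mathrm{dom}(\psi)\subseteq V$ a status of its out-going edges. A (deterministic) adaptive policy $\pi$ selects seeds one by one: starting from the empty partial realization, when the current partial realization is $\psi$ it either stops or selects a node $\pi(\psi)\notin\mathrm{dom}(\psi)$, and the pair $(\pi(\psi),\phi(\pi(\psi)))$ is then added to $\psi$. $V(\pi,\phi)$ is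 the set of nodes selected by $\pi$ under realization $\phi$. $\Pi(k)$ is the set of policies with $|V(\pi,\phi)|\le k$ for all $\phi$. The adaptive influence spread is $\sigma(\pi)=\mathbb E_{\Phi\sim\mathcal P}[f(V(\pi,\Phi),\Phi)]$. $\mathrm{OPT}_N(G,k)=\max_{S\subseteq V,\,|S|\le k}\sigma(S)$ and $\mathrm{OPT}_A(G,k)=\max_{\pi\in\Pi(k)}\sigma(\pi)$. *)

theory Defs
  imports "HOL-Probability.Probability" "HOL-Probability.Product_PMF"
begin

section \<open>Influence graphs and the independent cascade model\<close>

record 'v igraph =
  nodes :: "'v set"
  edges :: "('v \<times> 'v) set"
  eprob :: "'v \<times> 'v \<Rightarrow> real"

definition influence_graph :: "'v igraph \<Rightarrow> bool" where
  "influence_graph G \<longleftrightarrow>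
     finite (nodes G) \<and> nodes G \<noteq> {} \<and>
     edges G \<subseteq> nodes G \<times> nodes G \<and>
     (\<forall>e\<in>edges G. 0 \<le> eprob G e \<and> eprob G e \<le> 1)"

text \<open>
  A realization is a function \<open>\<phi>\<close> on pairs of nodes, where \<open>\<phi> e\<close> says that the edge \<open>e\<close> is live.
  Nothing below looks at \<open>\<phi>\<close> outside the edge set; under \<open>realization_pmf\<close> it is \<open>False\<close> there.
\<close>

type_synonym 'v realization = "'v \<times> 'v \<Rightarrow> bool"

definition realization_pmf :: "'v igraph \<Rightarrow> 'v realization pmf" where
  "realization_pmf G = Pi_pmf (edges G) False (\<lambda>e. bernoulli_pmf (eprob G e))"

definition live_edges :: "'v igraph \<Rightarrow> 'v realization \<Rightarrow> ('v \<times> 'v) set" where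
  "live_edges G \<phi> = {e \<in> edges G. \<phi> e}"

definition influenced :: "'v igraph \<Rightarrow> 'v set \<Rightarrow> 'v realization \<Rightarrow> 'v set" where
  "influenced G S \<phi> = (live_edges G \<phi>)\<^sup>* `` S"

definition f_spread :: "'v igraph \<Rightarrow> 'v set \<Rightarrow> 'v realization \<Rightarrow> nat" where
  "f_spread G S \<phi> = card (influenced G S \<phi>)"

definition spread :: "'v igraph \<Rightarrow> 'v set \<Rightarrow> real" where
  "spread G S = measure_pmf.expectation (realization_pmf G) (\<lambda>\<phi>. real (f_spread G S \<phi>))"

definition OPT_N :: "'v igraph \<Rightarrow> nat \<Rightarrow> real" where
  "OPT_N G k = Max {spread G S | S. S \<subseteq> nodes G \<and> card S \<le> k}"


section \<open>Adaptive policies with myopic feedback\<close>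

text \<open>
  The feedback of a node \<open>u\<close> is the map assigning to every out-neighbour \<open>v\<close> the status of
  the edge \<open>(u, v)\<close>. A policy stops by returning \<open>None\<close>.
\<close>

type_synonym 'v feedback = "'v \<rightharpoonup> bool"
type_synonym 'v partial_realization = "'v \<rightharpoonup> 'v feedback"
type_synonym 'v policy = "'v partial_realization \<Rightarrow> 'v option"

definition feedback :: "'v igraph \<Rightarrow> 'v realization \<Rightarrow> 'v \<Rightarrow> 'v feedback" where
  "feedback G \<phi> u = (\<lambda>v. if (u, v) \<in> edges G then Some (\<phi> (u, v)) else None)"

definition is_partial_realization :: "'v igraph \<Rightarrow> 'v partial_realization \<Rightarrow> bool" where
  "is_partial_realization G \<psi> \<longleftrightarrow>
     dom \<psi> \<subseteq> nodes G \<and> (\<forall>u s. \<psi> u = Some s \<longrightarrow> dom s = {v. (u, v) \<in> edges G})"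

definition is_policy :: "'v igraph \<Rightarrow> 'v policy \<Rightarrow> bool" where
  "is_policy G \<pi> \<longleftrightarrow>
     (\<forall>\<psi> u. is_partial_realization G \<psi> \<and> \<pi> \<psi> = Some u \<longrightarrow> u \<in> nodes G - dom \<psi>)"

definition policy_step ::
  "'v igraph \<Rightarrow> 'v policy \<Rightarrow> 'v realization \<Rightarrow> 'v partial_realization \<Rightarrow> 'v partial_realization" where
  "policy_step G \<pi> \<phi> \<psi> = (case \<pi> \<psi> of None \<Rightarrow> \<psi> | Some u \<Rightarrow> \<psi>(u \<mapsto> feedback G \<phi> u))"

definition policy_run ::
  "'v igraph \<Rightarrow> 'v policy \<Rightarrow> 'v realization \<Rightarrow> nat \<Rightarrow> 'v partial_realization" where
  "policy_run G \<pi> \<phi> n = (policy_step G \<pi> \<phi> ^^ n) Map.empty"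

definition selected :: "'v igraph \<Rightarrow> 'v policy \<Rightarrow> 'v realization \<Rightarrow> 'v set" where
  "selected G \<pi> \<phi> = {u. \<exists>n. \<pi> (policy_run G \<pi> \<phi> n) = Some u}"

definition policies :: "'v igraph \<Rightarrow> nat \<Rightarrow> 'v policy set" where
  "policies G k = {\<pi>. is_policy G \<pi> \<and> (\<forall>\<phi>. card (selected G \<pi> \<phi>) \<le> k)}"

definition adaptive_spread :: "'v igraph \<Rightarrow> 'v policy \<Rightarrow> real" where
  "adaptive_spread G \<pi> =
     measure_pmf.expectation (realization_pmf G) (\<lambda>\<phi>. real (f_spread G (selected G \<pi> \<phi>) \<phi>))"

definition OPT_A :: "'v igraph \<Rightarrow> nat \<Rightarrow> real" where
  "OPT_A G k = Max {adaptive_spread G \<pi> | \<pi>. \<pi> \<in> policies G k}"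


section \<open>The maxima range over finite nonempty sets, and \<open>OPT_N\<close> is positive\<close>

lemma finite_edges: "influence_graph G \<Longrightarrow> finite (edges G)"
  unfolding influence_graph_def by (meson finite_SigmaI finite_subset)

lemma finite_set_realization_pmf:
  assumes "influence_graph G"
  shows "finite (set_pmf (realization_pmf G))"
  unfolding realization_pmf_def
  by (rule finite_subset[OF set_Pi_pmf_subset'[OF finite_edges[OF assms]]])
     (intro finite_PiE_dflt finite_edges assms, auto)

lemma influenced_subset:
  assumes "influence_graph G" "S \<subseteq> nodes G"
  shows "influenced G S \<phi> \<subseteq> nodes G"
proof
  fix v assume "v \<in> influenced G S \<phi>"
  then obtain u where "u \<in> S" "(u, v) \<in> (live_edges G \<phi>)\<^sup>*"
    by (auto simp: influenced_def)
  from this(2) show "v \<in> nodes G"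
    by (cases rule: rtranclE)
       (use assms \<open>u \<in> S\<close> in \<open>auto simp: live_edges_def influence_graph_def\<close>)
qed

lemma is_partial_realization_policy_run:
  assumes "influence_graph G" "is_policy G \<pi>"
  shows "is_partial_realization G (policy_run G \<pi> \<phi> n)"
proof (induction n)
  case 0
  show ?case by (simp add: policy_run_def is_partial_realization_def)
next
  case (Suc n)
  show ?case
  proof (cases "\<pi> (policy_run G \<pi> \<phi> n)")
    case None
    with Suc show ?thesis by (simp add: policy_run_def policy_step_def)
  next
    case (Some u)
    have "u \<in> nodes G" using Some Suc assms by (auto simp: is_policy_def)
    moreover have "policy_run G \<pi> \<phi> (Suc n) = (policy_run G \<pi> \<phi> n)(u \<mapsto> feedback G \<phi> u)"
      using Some by (simp add: policy_run_def policy_step_def)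
    moreover have "dom (feedback G \<phi> u) = {v. (u, v) \<in> edges G}"
      by (auto simp: feedback_def dom_def)
    ultimately show ?thesis using Suc
      by (auto simp: is_partial_realization_def subset_iff domIff split: if_splits)
  qed
qed

lemma selected_subset:
  assumes "influence_graph G" "is_policy G \<pi>"
  shows "selected G \<pi> \<phi> \<subseteq> nodes G"
  using is_partial_realization_policy_run[OF assms] assms(2)
  by (auto simp: selected_def is_policy_def)

lemma finite_OPT_N_set:
  assumes "influence_graph G"
  shows "finite {spread G S | S. S \<subseteq> nodes G \<and> card S \<le> k}"
proof -
  have "finite (spread G ` Pow (nodes G))"
    using assms by (simp add: influence_graph_def)
  then show ?thesis by (rule rev_finite_subset) auto
qed

lemma OPT_N_set_nonempty: "{spread G S | S. S \<subseteq> nodes G \<and> card S \<le> k} \<noteq> {}"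
proof -
  have "{} \<subseteq> nodes G \<and> card ({} :: 'a set) \<le> k" by simp
  then show ?thesis by blast
qed

lemma finite_OPT_A_set:
  assumes "influence_graph G"
  shows "finite {adaptive_spread G \<pi> | \<pi>. \<pi> \<in> policies G k}"
proof -
  let ?R = "set_pmf (realization_pmf G)"
  define h where "h = (\<lambda>F. measure_pmf.expectation (realization_pmf G)
      (\<lambda>\<phi>. real (f_spread G (F \<phi>) \<phi>)))"
  have "finite (h ` (?R \<rightarrow>\<^sub>E Pow (nodes G)))"
    using finite_set_realization_pmf[OF assms] assms
    by (intro finite_imageI finite_PiE) (auto simp: influence_graph_def)
  moreover have "adaptive_spread G \<pi> \<in> h ` (?R \<rightarrow>\<^sub>E Pow (nodes G))" if "\<pi> \<in> policies G k" for \<pi>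
  proof
    show "restrict (selected G \<pi>) ?R \<in> ?R \<rightarrow>\<^sub>E Pow (nodes G)"
      using selected_subset[OF assms] that by (auto simp: policies_def)
    show "adaptive_spread G \<pi> = h (restrict (selected G \<pi>) ?R)"
      unfolding adaptive_spread_def h_def
      by (intro integral_cong_AE) (auto simp: AE_measure_pmf_iff)
  qed
  ultimately show ?thesis by (elim rev_finite_subset) auto
qed

lemma OPT_A_set_nonempty: "{adaptive_spread G \<pi> | \<pi>. \<pi> \<in> policies G k} \<noteq> {}"
proof -
  have "(\<lambda>_. None) \<in> policies G k"
    by (simp add: policies_def is_policy_def selected_def)
  then show ?thesis by blast
qed

lemma OPT_N_ge_1:
  assumes "influence_graph G" "1 \<le> k"
  shows "1 \<le> OPT_N G k"
proof -
  obtain v where v: "v \<in> nodes G" using assms by (auto simp: influence_graph_def)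
  have "1 \<le> f_spread G {v} \<phi>" for \<phi>
  proof -
    have "{v} \<subseteq> influenced G {v} \<phi>" by (auto simp: influenced_def)
    moreover have "finite (influenced G {v} \<phi>)"
      using influenced_subset[OF assms(1), of "{v}" \<phi>] v assms(1) finite_subset
      unfolding influence_graph_def by blast
    ultimately show ?thesis
      unfolding f_spread_def by (metis card_mono card.insert card.empty finite.emptyI
          empty_iff One_nat_def)
  qed
  then have "1 \<le> spread G {v}"
    unfolding spread_def
    by (intro measure_pmf.integral_ge_const integrable_measure_pmf_finite
        finite_set_realization_pmf assms) (auto simp: AE_measure_pmf_iff)
  also have "spread G {v} \<le> OPT_N G k"
    unfolding OPT_N_def
  proof (intro Max_ge finite_OPT_N_set[OF assms(1)])
    have "{v} \<subseteq> nodes G \<and> card {v} \<le> k" using v assms(2) by simp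
    then show "spread G {v} \<in> {spread G S | S. S \<subseteq> nodes G \<and> card S \<le> k}" by blast
  qed
  finally show ?thesis .
qed

end

theory Submission
  imports Defs "HOL-Library.Nat_Bijection" "HOL-Real_Asymp.Real_Asymp"
begin

text \<open>
  The gap instance is bipartite, with \<open>N = m ^ 3\<close> targets. For each set \<open>X\<close> of at most \<open>d = m ^ 2\<close>
  targets there are seeds with an edge of probability \<open>p = 1 / m\<close> to every element of \<open>X\<close>, and the
  budget is \<open>k = m ^ 2\<close>. A target receives on average at most \<open>m\<close> edges from \<open>k\<close> fixed seeds, so by
  convexity of \<open>n \<mapsto> (1 - p) ^ n\<close> a nonadaptive choice reaches at most a fraction
  \<open>1 - (1 - 1 / m) ^ m\<close> of the targets, up to lower order terms. The adaptive policy that always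
  aims at \<open>d\<close> inactive targets gains \<open>d * p = m\<close> of them per step in expectation, and a second moment
  bound shows that it activates almost all of them.
\<close>

section \<open>Resampling coordinates of a product distribution\<close>

lemma expectation_bind_pmf_finite:
  fixes h :: "'b \<Rightarrow> real"
  assumes "finite (set_pmf p)" "\<And>x. x \<in> set_pmf p \<Longrightarrow> finite (set_pmf (f x))"
  shows "measure_pmf.expectation (p \<bind> f) h =
    measure_pmf.expectation p (\<lambda>x. measure_pmf.expectation (f x) h)"
proof -
  have "measure_pmf.expectation (p \<bind> f) h =
      (\<Sum>a\<in>set_pmf p. pmf p a *\<^sub>R measure_pmf.expectation (f a) h)"
    by (rule pmf_expectation_bind) (use assms in auto)
  also have "\<dots> = measure_pmf.expectation p (\<lambda>x. measure_pmf.expectation (f x) h)"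
    by (rule integral_measure_pmf[symmetric]) (use assms in auto)
  finally show ?thesis .
qed

text \<open>The coordinates in \<open>B\<close> are independent of the others, so overwriting them
  with those of an independent copy leaves the law unchanged. This stands in for conditioning on the
  edges outside \<open>B\<close>.\<close>

lemma Pi_pmf_resample:
  assumes "finite E" "B \<subseteq> E"
  shows "Pi_pmf E dflt p =
    Pi_pmf E dflt p \<bind> (\<lambda>f. map_pmf (\<lambda>g x. if x \<in> B then g x else f x) (Pi_pmf E dflt p))"
proof -
  let ?P = "Pi_pmf E dflt p"
  have fin: "finite B" using assms by (rule finite_subset[rotated])
  have "?P = Pi_pmf (B \<union> (E - B)) dflt p"
    using assms by (simp add: Un_absorb1)
  also have "\<dots> = map_pmf (\<lambda>(f, g) x. if x \<in> B then f x else g x)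
      (pair_pmf (Pi_pmf B dflt p) (Pi_pmf (E - B) dflt p))"
    by (rule Pi_pmf_union) (use assms fin in auto)
  also have "Pi_pmf B dflt p = map_pmf (\<lambda>f x. if x \<in> B then f x else dflt) ?P"
    by (rule Pi_pmf_subset) (use assms in auto)
  also have "Pi_pmf (E - B) dflt p = map_pmf (\<lambda>f x. if x \<in> E - B then f x else dflt) ?P"
    by (rule Pi_pmf_subset) (use assms in auto)
  also have "map_pmf (\<lambda>(f, g) x. if x \<in> B then f x else g x)
      (pair_pmf (map_pmf (\<lambda>f x. if x \<in> B then f x else dflt) ?P)
        (map_pmf (\<lambda>f x. if x \<in> E - B then f x else dflt) ?P)) =
      map_pmf (\<lambda>(f, g) x. if x \<in> B then f x else if x \<in> E then g x else dflt) (pair_pmf ?P ?P)"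
    unfolding map_pair[symmetric] map_pmf_comp
    by (intro map_pmf_cong refl) (auto simp: fun_eq_iff)
  \<comment> \<open>On the support of \<open>?P\<close> every function equals \<open>dflt\<close>
    outside \<open>E\<close>, which makes the inner case distinction collapse.\<close>
  also have "\<dots> = map_pmf (\<lambda>(f, g) x. if x \<in> B then f x else g x) (pair_pmf ?P ?P)"
  proof (intro map_pmf_cong refl)
    fix y assume "y \<in> set_pmf (pair_pmf ?P ?P)"
    then have "snd y \<in> PiE_dflt E dflt (set_pmf \<circ> p)"
      using set_Pi_pmf_subset'[OF assms(1), of dflt p] by auto
    then show "(case y of (f, g) \<Rightarrow> \<lambda>x. if x \<in> B then f x else if x \<in> E then g x else dflt) =
        (case y of (f, g) \<Rightarrow> \<lambda>x. if x \<in> B then f x else g x)"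
      by (auto simp: PiE_dflt_def fun_eq_iff split: prod.split)
  qed
  also have "\<dots> = map_pmf (\<lambda>(f, g) x. if x \<in> B then g x else f x) (pair_pmf ?P ?P)"
    by (subst pair_commute_pmf, unfold map_pmf_comp, intro map_pmf_cong refl) auto
  also have "\<dots> = ?P \<bind> (\<lambda>f. map_pmf (\<lambda>g x. if x \<in> B then g x else f x) ?P)"
    by (simp add: pair_pmf_def map_pmf_def bind_assoc_pmf bind_return_pmf)
  finally show ?thesis .
qed

lemma expectation_Pi_pmf_resample:
  fixes h :: "('a \<Rightarrow> 'b) \<Rightarrow> real"
  assumes "finite E" "B \<subseteq> E" "finite (set_pmf (Pi_pmf E dflt p))"
  shows "measure_pmf.expectation (Pi_pmf E dflt p) h =
    measure_pmf.expectation (Pi_pmf E dflt p) (\<lambda>f.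
      measure_pmf.expectation (Pi_pmf E dflt p) (\<lambda>g. h (\<lambda>x. if x \<in> B then g x else f x)))"
  by (subst Pi_pmf_resample[OF assms(1,2)], subst expectation_bind_pmf_finite)
     (use assms(3) in auto)

section \<open>Binomial moments, missed edges and a convexity bound\<close>

lemma finite_set_binomial_pmf: "p \<in> {0..1} \<Longrightarrow> finite (set_pmf (binomial_pmf n p))"
  by (rule finite_subset[of _ "{..n}"]) (auto simp: set_pmf_binomial_eq split: if_splits)

lemma expectation_binomial_pmf_Suc:
  fixes h :: "nat \<Rightarrow> real"
  assumes "p \<in> {0..1}"
  shows "measure_pmf.expectation (binomial_pmf (Suc n) p) h =
    p * measure_pmf.expectation (binomial_pmf n p) (\<lambda>i. h (Suc i)) +
    (1 - p) * measure_pmf.expectation (binomial_pmf n p) h"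
  using assms finite_set_binomial_pmf[OF assms, of n]
  by (simp add: binomial_pmf_Suc expectation_bind_pmf_finite map_pmf_def[symmetric] algebra_simps)

lemma binomial_pmf_integrable [simp]:
  fixes h :: "nat \<Rightarrow> real"
  shows "p \<in> {0..1} \<Longrightarrow> integrable (measure_pmf (binomial_pmf n p)) h"
  by (rule integrable_measure_pmf_finite[OF finite_set_binomial_pmf])

lemma binomial_pmf_mean:
  assumes "p \<in> {0..1}"
  shows "measure_pmf.expectation (binomial_pmf n p) real = real n * p"
proof (induction n)
  case (Suc n)
  then show ?case
    using assms by (simp only: expectation_binomial_pmf_Suc of_nat_Suc) (simp add: algebra_simps)
qed (use assms in \<open>simp add: binomial_pmf_0\<close>)

lemma binomial_pmf_second_moment:
  assumes "p \<in> {0..1}"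
  shows "measure_pmf.expectation (binomial_pmf n p) (\<lambda>i. (real i)\<^sup>2) =
    real n * p * (1 - p) + (real n * p)\<^sup>2"
proof (induction n)
  case (Suc n)
  have "measure_pmf.expectation (binomial_pmf n p) (\<lambda>i. (real (Suc i))\<^sup>2) =
      measure_pmf.expectation (binomial_pmf n p) (\<lambda>i. (real i)\<^sup>2 + 2 * real i + 1)"
    by (simp add: power2_eq_square algebra_simps)
  also have "\<dots> = real n * p * (1 - p) + (real n * p)\<^sup>2 + 2 * (real n * p) + 1"
    using assms by (simp add: Suc binomial_pmf_mean)
  finally show ?case
    using assms Suc by (simp only: expectation_binomial_pmf_Suc)
      (simp add: algebra_simps power2_eq_square)
qed (use assms in \<open>simp add: binomial_pmf_0\<close>)

text \<open>The cross term vanishes because the deviation from the mean is centred. The shift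
  \<open>c\<close> will be the predicted deviation of the inactive count in
  \<open>lower_step\<close>.\<close>

lemma binomial_pmf_variance:
  assumes "p \<in> {0..1}"
  shows "measure_pmf.expectation (binomial_pmf n p) (\<lambda>i. (c - (real i - real n * p))\<^sup>2) =
    c\<^sup>2 + real n * p * (1 - p)"
proof -
  have "measure_pmf.expectation (binomial_pmf n p) (\<lambda>i. (c - (real i - real n * p))\<^sup>2) =
      measure_pmf.expectation (binomial_pmf n p)
        (\<lambda>i. (real i)\<^sup>2 - 2 * (c + real n * p) * real i + (c + real n * p)\<^sup>2)"
    by (intro Bochner_Integration.integral_cong) (auto simp: power2_eq_square algebra_simps)
  also have "\<dots> = real n * p * (1 - p) + (real n * p)\<^sup>2
      - 2 * (c + real n * p) * (real n * p) + (c + real n * p)\<^sup>2"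
    using assms by (simp add: binomial_pmf_mean binomial_pmf_second_moment)
  finally show ?thesis by (simp add: power2_eq_square algebra_simps)
qed

lemma expectation_none_live:
  assumes "finite E" "D \<subseteq> E" "p \<in> {0..1}"
  shows "measure_pmf.expectation (Pi_pmf E False (\<lambda>_. bernoulli_pmf p))
    (\<lambda>\<phi>. of_bool (\<forall>e\<in>D. \<not> \<phi> e)) = (1 - p) ^ card D"
proof -
  \<comment> \<open>Padding with factors 1 outside \<open>D\<close> gives a product over all of
    \<open>E\<close>, to which independence applies.\<close>
  have "of_bool (\<forall>e\<in>D. \<not> \<phi> e) = (\<Prod>e\<in>E. if e \<in> D then of_bool (\<not> \<phi> e) else (1::real))" for \<phi>
    using assms by (subst prod.mono_neutral_right[of E D])
      (auto intro!: prod_zero finite_subset[of D E])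
  then have "measure_pmf.expectation (Pi_pmf E False (\<lambda>_. bernoulli_pmf p))
      (\<lambda>\<phi>. of_bool (\<forall>e\<in>D. \<not> \<phi> e)) =
    measure_pmf.expectation (Pi_pmf E False (\<lambda>_. bernoulli_pmf p))
      (\<lambda>\<phi>. \<Prod>e\<in>E. (if e \<in> D then of_bool (\<not> \<phi> e) else (1::real)))"
    by simp
  also have "\<dots> = (\<Prod>e\<in>E. measure_pmf.expectation (bernoulli_pmf p)
      (\<lambda>b. if e \<in> D then of_bool (\<not> b) else 1))"
    by (rule expectation_prod_Pi_pmf[of E _ "\<lambda>e b. if e \<in> D then of_bool (\<not> b) else 1"])
       (use assms in \<open>auto intro!: integrable_measure_pmf_finite\<close>)
  also have "\<dots> = (\<Prod>e\<in>E. if e \<in> D then 1 - p else 1)"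
    using assms by (intro prod.cong) auto
  also have "\<dots> = (1 - p) ^ card D"
    using assms by (simp add: prod.If_cases Int_absorb1)
  finally show ?thesis .
qed

text \<open>The convex function \<open>n \<mapsto> q ^ n\<close> lies above its tangent at
  \<open>r\<close>; after factoring out \<open>q ^ r\<close> this is
  \<open>1 + x \<le> exp x\<close>.\<close>

lemma power_ge_tangent:
  fixes q :: real
  assumes "0 < q"
  shows "q ^ r * (1 + (real n - real r) * ln q) \<le> q ^ n"
proof -
  have "q ^ r * (1 + (real n - real r) * ln q) \<le> q ^ r * exp ((real n - real r) * ln q)"
    using assms by (intro mult_left_mono) auto
  also have "\<dots> = exp (real r * ln q) * exp ((real n - real r) * ln q)"
    using assms by (simp add: exp_of_nat_mult)
  also have "\<dots> = exp (real n * ln q)"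
    by (simp add: exp_add[symmetric] algebra_simps)
  also have "\<dots> = q ^ n"
    using assms by (simp add: exp_of_nat_mult)
  finally show ?thesis .
qed

section \<open>The bipartite gap instance\<close>

locale gap_instance =
  fixes N d k :: nat and p :: real
  assumes p_pos: "0 < p" and p_less_1: "p < 1" and k_pos: "1 \<le> k" and d_pos: "1 \<le> d"
begin

text \<open>
  Each set \<open>X\<close> gets \<open>k\<close> copies \<open>seed X j\<close>. The policy uses copy \<open>j\<close> in step \<open>j\<close>, so that the edges
  it reveals are independent of everything seen before, even if \<open>X\<close> is picked repeatedly.
\<close>

definition seed :: "nat set \<Rightarrow> nat \<Rightarrow> nat" where
  "seed X j = N + prod_encode (set_encode X, j)"

definition blocks :: "nat set set" where
  "blocks = {X. X \<subseteq> {..<N} \<and> card X \<le> d}"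

definition gap_graph :: "nat igraph" where
  "gap_graph = \<lparr>nodes = {..<N} \<union> (\<lambda>(X, j). seed X j) ` (blocks \<times> {..<k}),
    edges = (\<Union>(X, j) \<in> blocks \<times> {..<k}. {seed X j} \<times> X),
    eprob = (\<lambda>_. p)\<rparr>"

lemma finite_blocks: "finite blocks"
  by (rule finite_subset[of _ "Pow {..<N}"]) (auto simp: blocks_def)

lemma finite_block: "X \<in> blocks \<Longrightarrow> finite X"
  by (auto simp: blocks_def intro: finite_subset)

lemma seed_eq_iff: "finite X \<Longrightarrow> finite Y \<Longrightarrow> seed X i = seed Y j \<longleftrightarrow> X = Y \<and> i = j"
  by (auto simp: seed_def set_encode_eq)

lemma seed_ge: "N \<le> seed X j"
  by (simp add: seed_def)

lemma seed_edge_iff: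
  assumes "X \<in> blocks"
  shows "(seed X j, v) \<in> edges gap_graph \<longleftrightarrow> j < k \<and> v \<in> X"
  using assms by (auto simp: gap_graph_def seed_eq_iff finite_block)

lemma edgeD:
  assumes "(u, v) \<in> edges gap_graph"
  shows "N \<le> u" "v < N"
  using assms seed_ge by (auto simp: gap_graph_def blocks_def)

lemma influence_graph_gap_graph: "influence_graph gap_graph"
proof -
  \<comment> \<open>The empty block supplies a node even when \<open>N = 0\<close>.\<close>
  have "seed {} 0 \<in> nodes gap_graph"
    using k_pos by (force simp: gap_graph_def blocks_def)
  then show ?thesis
    using finite_blocks p_pos p_less_1
    by (auto simp: influence_graph_def) (auto simp: gap_graph_def blocks_def)
qed

lemma nodes_gap_graph_cases:
  assumes "u \<in> nodes gap_graph"
  obtains "u < N" | X j where "X \<in> blocks" "j < k" "u = seed X j"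
  using assms by (auto simp: gap_graph_def)

lemma finite_edges_gap_graph: "finite (edges gap_graph)"
  by (rule finite_edges[OF influence_graph_gap_graph])

lemma realization_pmf_gap_graph:
  "realization_pmf gap_graph = Pi_pmf (edges gap_graph) False (\<lambda>_. bernoulli_pmf p)"
  by (simp add: realization_pmf_def gap_graph_def)

lemma integrable_gap_graph [simp]:
  "integrable (measure_pmf (realization_pmf gap_graph)) (h :: _ \<Rightarrow> real)"
  by (rule integrable_measure_pmf_finite[OF finite_set_realization_pmf[OF influence_graph_gap_graph]])

lemma card_out_edges:
  assumes "u \<in> nodes gap_graph"
  shows "card {v. (u, v) \<in> edges gap_graph} \<le> d"
  using assms
proof (cases rule: nodes_gap_graph_cases)
  case 1
  then have "{v. (u, v) \<in> edges gap_graph} = {}" using edgeD by fastforce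
  then show ?thesis by (simp only: card.empty)
next
  case (2 X j)
  then have "{v. (u, v) \<in> edges gap_graph} = X" by (simp add: seed_edge_iff)
  then show ?thesis using 2 by (simp add: blocks_def)
qed

section \<open>Upper bound for nonadaptive seed sets\<close>

text \<open>Edges lead from numbers at least \<open>N\<close> to numbers below \<open>N\<close>, so
  a live path has at most one edge.\<close>

lemma influenced_gap_graph_subset:
  "influenced gap_graph S \<phi> \<subseteq> S \<union> {v\<in>{..<N}. \<exists>u\<in>S. (u, v) \<in> edges gap_graph \<and> \<phi> (u, v)}"
proof
  fix v assume "v \<in> influenced gap_graph S \<phi>"
  then obtain u where u: "u \<in> S" "(u, v) \<in> (live_edges gap_graph \<phi>)\<^sup>*"
    by (auto simp: influenced_def)
  from u(2) show "v \<in> S \<union> {v\<in>{..<N}. \<exists>u\<in>S. (u, v) \<in> edges gap_graph \<and> \<phi> (u, v)}"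
  proof (cases rule: rtranclE)
    case base
    with u show ?thesis by simp
  next
    case (step w)
    from step(1) have "w = u"
    proof (cases rule: rtranclE)
      case (step y)
      then show ?thesis using \<open>(w, v) \<in> live_edges gap_graph \<phi>\<close> edgeD
        by (fastforce simp: live_edges_def)
    qed simp
    with step(2) u edgeD show ?thesis by (auto simp: live_edges_def)
  qed
qed

text \<open>Each seed is charged 1 for itself; a target is missed exactly when all its edges from
  \<open>S\<close> are blocked, and these are independent.\<close>

lemma spread_gap_graph_le:
  assumes S: "S \<subseteq> nodes gap_graph"
  shows "spread gap_graph S \<le> real (card S) +
    (\<Sum>v<N. 1 - (1 - p) ^ card {u\<in>S. (u, v) \<in> edges gap_graph})"
proof -
  let ?D = "\<lambda>v. (\<lambda>u. (u, v)) ` {u\<in>S. (u, v) \<in> edges gap_graph}"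
  let ?P = "realization_pmf gap_graph"
  have finS: "finite S"
    using S influence_graph_gap_graph finite_subset by (auto simp: influence_graph_def)
  have f_le: "real (f_spread gap_graph S \<phi>) \<le>
      real (card S) + (\<Sum>v<N. 1 - of_bool (\<forall>e\<in>?D v. \<not> \<phi> e))" for \<phi>
  proof -
    let ?T = "{v\<in>{..<N}. \<exists>u\<in>S. (u, v) \<in> edges gap_graph \<and> \<phi> (u, v)}"
    have "f_spread gap_graph S \<phi> \<le> card (S \<union> ?T)"
      unfolding f_spread_def using finS by (intro card_mono influenced_gap_graph_subset) auto
    also have "\<dots> \<le> card S + card ?T" by (rule card_Un_le)
    finally have "real (f_spread gap_graph S \<phi>) \<le> real (card S) + real (card ?T)" by linarith
    also have "real (card ?T) = (\<Sum>v<N. of_bool (v \<in> ?T))"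
      by (simp add: sum.If_cases of_bool_def Int_def)
    also have "\<dots> = (\<Sum>v<N. 1 - of_bool (\<forall>e\<in>?D v. \<not> \<phi> e))"
      by (intro sum.cong) auto
    finally show ?thesis .
  qed
  have none_live: "measure_pmf.expectation ?P (\<lambda>\<phi>. of_bool (\<forall>e\<in>?D v. \<not> \<phi> e)) =
      (1 - p) ^ card {u\<in>S. (u, v) \<in> edges gap_graph}" for v
    unfolding realization_pmf_gap_graph
    by (subst expectation_none_live) (use finite_edges_gap_graph p_pos p_less_1 in
        \<open>auto simp: card_image inj_on_def\<close>)
  from f_le have "spread gap_graph S \<le> measure_pmf.expectation ?P
      (\<lambda>\<phi>. real (card S) + (\<Sum>v<N. 1 - of_bool (\<forall>e\<in>?D v. \<not> \<phi> e)))"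
    unfolding spread_def by (intro integral_mono) auto
  also have "\<dots> = real (card S) +
      (\<Sum>v<N. 1 - measure_pmf.expectation ?P (\<lambda>\<phi>. of_bool (\<forall>e\<in>?D v. \<not> \<phi> e)))"
    by (simp del: of_bool_eq)
  also have "\<dots> = real (card S) + (\<Sum>v<N. 1 - (1 - p) ^ card {u\<in>S. (u, v) \<in> edges gap_graph})"
    by (simp only: none_live)
  finally show ?thesis .
qed

text \<open>Double counting of the edges leaving \<open>S\<close>.\<close>

lemma sum_in_degrees_le:
  assumes "S \<subseteq> nodes gap_graph"
  shows "(\<Sum>v<N. card {u\<in>S. (u, v) \<in> edges gap_graph}) \<le> card S * d"
proof -
  have finS: "finite S"
    using assms influence_graph_gap_graph finite_subset by (auto simp: influence_graph_def)
  have "(\<Sum>v<N. card {u\<in>S. (u, v) \<in> edges gap_graph}) =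
      (\<Sum>u\<in>S. card {v\<in>{..<N}. (u, v) \<in> edges gap_graph})"
    using sum.swap[of "\<lambda>v u. of_bool ((u, v) \<in> edges gap_graph) :: nat" S "{..<N}"] finS
    by (simp add: sum.If_cases of_bool_def Int_def)
  also have "\<dots> = (\<Sum>u\<in>S. card {v. (u, v) \<in> edges gap_graph})"
    by (intro sum.cong arg_cong[of _ _ card] refl) (use edgeD in auto)
  also have "\<dots> \<le> (\<Sum>u\<in>S. d)"
    using assms by (intro sum_mono card_out_edges) auto
  finally show ?thesis by simp
qed

text \<open>The hypothesis bounds the average in-degree from \<open>k\<close> seeds by
  \<open>r\<close>; the tangent at \<open>r\<close>, summed over the targets, then bounds the number
  of missed ones from below.\<close>

lemma OPT_N_gap_graph_le:
  assumes r: "k * d \<le> r * N"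
  shows "OPT_N gap_graph k \<le> real k + real N * (1 - (1 - p) ^ r)"
proof -
  let ?q = "1 - p"
  have q: "0 < ?q" "ln ?q \<le> 0" using p_pos p_less_1 by auto
  have "spread gap_graph S \<le> real k + real N * (1 - ?q ^ r)"
    if S: "S \<subseteq> nodes gap_graph" "card S \<le> k" for S
  proof -
    let ?n = "\<lambda>v. card {u\<in>S. (u, v) \<in> edges gap_graph}"
    have "(\<Sum>v<N. ?n v) \<le> r * N"
      using sum_in_degrees_le[OF S(1)] S(2) r by (meson le_trans mult_le_mono1)
    then have "real (\<Sum>v<N. ?n v) - real r * real N \<le> 0"
      by (simp only: diff_le_0_iff_le of_nat_le_iff flip: of_nat_mult)
    \<comment> \<open>An in-degree total below \<open>r * N\<close> only helps, since the slope
      \<open>ln ?q\<close> is nonpositive as well.\<close>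
    then have "0 \<le> ?q ^ r * ((real (\<Sum>v<N. ?n v) - real r * real N) * ln ?q)"
      using q by (intro mult_nonneg_nonneg mult_nonpos_nonpos) auto
    then have "real N * ?q ^ r \<le> ?q ^ r * (real N + (real (\<Sum>v<N. ?n v) - real r * real N) * ln ?q)"
      by (simp add: algebra_simps)
    also have "\<dots> = (\<Sum>v<N. ?q ^ r * (1 + (real (?n v) - real r) * ln ?q))"
      by (simp add: sum_distrib_left[symmetric] sum.distrib sum_distrib_right[symmetric]
          sum_subtractf mult.commute)
    also have "\<dots> \<le> (\<Sum>v<N. ?q ^ ?n v)"
      using q by (intro sum_mono power_ge_tangent)
    finally have "(\<Sum>v<N. 1 - ?q ^ ?n v) \<le> real N * (1 - ?q ^ r)"
      by (simp add: sum_subtractf algebra_simps)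
    with spread_gap_graph_le[OF S(1)] S(2) show ?thesis by linarith
  qed
  then show ?thesis
    unfolding OPT_N_def using finite_OPT_N_set[OF influence_graph_gap_graph] OPT_N_set_nonempty
    by (intro Max.boundedI) auto
qed


section \<open>The greedy adaptive policy and its run\<close>

definition pick :: "nat set \<Rightarrow> nat set" where
  "pick I = (SOME X. X \<subseteq> I \<and> card X = min d (card I))"

lemma pick:
  assumes "finite I"
  shows "pick I \<subseteq> I" "card (pick I) = min d (card I)"
proof -
  obtain X where "X \<subseteq> I" "card X = min d (card I)"
    by (rule obtain_subset_with_card_n[of "min d (card I)" I, OF min.cobounded2])
  then have "pick I \<subseteq> I \<and> card (pick I) = min d (card I)"
    unfolding pick_def by (intro someI[where P = "\<lambda>X. X \<subseteq> I \<and> card X = min d (card I)"] conjI)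
  then show "pick I \<subseteq> I" "card (pick I) = min d (card I)" by auto
qed

lemma pick_in_blocks:
  assumes "I \<subseteq> {..<N}"
  shows "pick I \<in> blocks"
  using pick[of I] assms finite_subset[OF assms] by (auto simp: blocks_def)

text \<open>A recursion on the realization itself, not on the run, so that the edges it depends on
  can be read off; \<open>policy_run_greedy\<close> links it to the policy.\<close>

primrec inactive :: "nat realization \<Rightarrow> nat \<Rightarrow> nat set" where
  "inactive \<phi> 0 = {..<N}"
| "inactive \<phi> (Suc j) = inactive \<phi> j -
     {v\<in>pick (inactive \<phi> j). \<phi> (seed (pick (inactive \<phi> j)) j, v)}"

definition chosen :: "nat realization \<Rightarrow> nat \<Rightarrow> nat" where
  "chosen \<phi> j = seed (pick (inactive \<phi> j)) j"

lemma inactive_subset: "inactive \<phi> j \<subseteq> {..<N}"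
  by (induction j) auto

lemma finite_inactive [simp]: "finite (inactive \<phi> j)"
  using inactive_subset finite_subset by blast

lemma pick_inactive_in_blocks: "pick (inactive \<phi> j) \<in> blocks"
  by (rule pick_in_blocks[OF inactive_subset])

lemma chosen_eq_iff: "chosen \<phi> i = chosen \<phi> j \<longleftrightarrow> i = j"
  unfolding chosen_def by (auto simp: seed_eq_iff finite_block[OF pick_inactive_in_blocks])

text \<open>Step \<open>i\<close> reads only edges of copies with index \<open>i\<close>. Hence the
  edges of copy \<open>j\<close> are still fresh when step \<open>j\<close> begins.\<close>

lemma inactive_cong:
  assumes "\<And>X i v. X \<in> blocks \<Longrightarrow> i < j \<Longrightarrow> v \<in> X \<Longrightarrow> \<phi> (seed X i, v) = \<phi>' (seed X i, v)"
  shows "inactive \<phi> j = inactive \<phi>' j"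
  using assms
proof (induction j)
  case (Suc j)
  have "inactive \<phi> j = inactive \<phi>' j"
    by (rule Suc.IH) (use Suc.prems in auto)
  then show ?case
    using Suc.prems[OF pick_inactive_in_blocks[of \<phi>' j]] by auto
qed simp

definition activated :: "nat partial_realization \<Rightarrow> nat set" where
  "activated \<psi> = {v. \<exists>u s. \<psi> u = Some s \<and> s v = Some True}"

text \<open>
  The test \<open>u \<notin> dom \<psi>\<close> never fails during a run; it makes \<open>greedy\<close> a policy also on
  partial realizations that no run produces.
\<close>

definition greedy :: "nat policy" where
  "greedy \<psi> = (let u = seed (pick ({..<N} - activated \<psi>)) (card (dom \<psi>))
     in if card (dom \<psi>) < k \<and> u \<notin> dom \<psi> then Some u else None)"

lemma is_policy_greedy: "is_policy gap_graph greedy"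
  using pick_in_blocks
  by (auto simp: is_policy_def greedy_def Let_def gap_graph_def split: if_splits)

lemma activated_upd:
  assumes "u \<notin> dom \<psi>"
  shows "activated (\<psi>(u \<mapsto> s)) = activated \<psi> \<union> {v. s v = Some True}"
  using assms by (auto simp: activated_def domIff) (metis option.distinct(1))+

text \<open>Run invariant. The chosen seeds are distinct because their copy indices differ, so
  \<open>card (dom \<psi>)\<close> in \<open>greedy\<close> is the step number.\<close>

lemma policy_run_greedy:
  assumes "n \<le> k"
  shows "dom (policy_run gap_graph greedy \<phi> n) = chosen \<phi> ` {..<n} \<and>
    {..<N} - activated (policy_run gap_graph greedy \<phi> n) = inactive \<phi> n"
  using assms
proof (induction n)
  case 0
  show ?case by (simp add: policy_run_def activated_def)
next
  case (Suc n)
  let ?\<psi> = "policy_run gap_graph greedy \<phi> n"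
  have dom: "dom ?\<psi> = chosen \<phi> ` {..<n}" and act: "{..<N} - activated ?\<psi> = inactive \<phi> n"
    using Suc by auto
  have card: "card (dom ?\<psi>) = n"
    unfolding dom by (subst card_image) (auto simp: inj_on_def chosen_eq_iff)
  have new: "chosen \<phi> n \<notin> dom ?\<psi>"
    unfolding dom by (auto simp: chosen_eq_iff)
  have "greedy ?\<psi> = Some (chosen \<phi> n)"
    using Suc.prems new by (simp add: greedy_def Let_def card act chosen_def)
  then have step: "policy_run gap_graph greedy \<phi> (Suc n) =
      ?\<psi>(chosen \<phi> n \<mapsto> feedback gap_graph \<phi> (chosen \<phi> n))"
    by (simp add: policy_run_def policy_step_def)
  have "{v. feedback gap_graph \<phi> (chosen \<phi> n) v = Some True} =
      {v\<in>pick (inactive \<phi> n). \<phi> (chosen \<phi> n, v)}"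
    using Suc.prems
    by (auto simp: feedback_def chosen_def seed_edge_iff[OF pick_inactive_in_blocks])
  then have "{..<N} - activated (policy_run gap_graph greedy \<phi> (Suc n)) = inactive \<phi> (Suc n)"
    using act unfolding step activated_upd[OF new] by (auto simp: chosen_def)
  moreover have "dom (policy_run gap_graph greedy \<phi> (Suc n)) = chosen \<phi> ` {..<Suc n}"
    by (simp add: step lessThan_Suc dom)
  ultimately show ?case by blast
qed

lemma greedy_policy_run:
  "greedy (policy_run gap_graph greedy \<phi> n) = (if n < k then Some (chosen \<phi> n) else None)"
proof -
  have card: "card (chosen \<phi> ` {..<i}) = i" for i
    by (subst card_image) (auto simp: inj_on_def chosen_eq_iff)
  have stop: "greedy (policy_run gap_graph greedy \<phi> k) = None"
    using policy_run_greedy[of k \<phi>] by (simp add: greedy_def Let_def card)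
  show ?thesis
  proof (cases "n < k")
    case True
    then have "chosen \<phi> n \<notin> chosen \<phi> ` {..<n}" by (auto simp: chosen_eq_iff)
    with True policy_run_greedy[of n \<phi>] show ?thesis
      by (simp add: greedy_def Let_def card flip: chosen_def)
  next
    case False
    then have "k \<le> n" by simp
    \<comment> \<open>Once the policy has stopped, further steps leave the partial realization
      fixed.\<close>
    then have "policy_run gap_graph greedy \<phi> n = policy_run gap_graph greedy \<phi> k"
    proof (induction n rule: dec_induct)
      case (step n)
      then show ?case using stop by (simp add: policy_run_def policy_step_def)
    qed auto
    with stop False show ?thesis by simp
  qed
qed

lemma selected_greedy: "selected gap_graph greedy \<phi> = chosen \<phi> ` {..<k}"
  by (auto simp: selected_def greedy_policy_run split: if_splits)

lemma greedy_in_policies: "greedy \<in> policies gap_graph k"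
  using is_policy_greedy card_image_le[of "{..<k}"] by (auto simp: policies_def selected_greedy)

lemma live_edge_if_not_inactive:
  assumes "v < N" "v \<notin> inactive \<phi> n"
  shows "\<exists>j<n. v \<in> pick (inactive \<phi> j) \<and> \<phi> (chosen \<phi> j, v)"
  using assms
proof (induction n)
  case (Suc n)
  then show ?case
    by (cases "v \<in> inactive \<phi> n") (auto simp: chosen_def less_Suc_eq)
qed simp

text \<open>Only targets are counted: each one that left the inactive set did so through a live edge
  from a chosen seed.\<close>

lemma f_spread_greedy_ge:
  "real N - real (card (inactive \<phi> k)) \<le> real (f_spread gap_graph (selected gap_graph greedy \<phi>) \<phi>)"
proof -
  let ?T = "influenced gap_graph (selected gap_graph greedy \<phi>) \<phi>"
  have "{..<N} - inactive \<phi> k \<subseteq> ?T"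
  proof
    fix v assume "v \<in> {..<N} - inactive \<phi> k"
    then obtain j where j: "j < k" "v \<in> pick (inactive \<phi> j)" "\<phi> (chosen \<phi> j, v)"
      using live_edge_if_not_inactive by blast
    then have "(chosen \<phi> j, v) \<in> live_edges gap_graph \<phi>"
      by (simp add: live_edges_def chosen_def seed_edge_iff[OF pick_inactive_in_blocks])
    with j(1) show "v \<in> ?T" by (auto simp: influenced_def selected_greedy)
  qed
  moreover have "finite ?T"
    using influenced_subset[OF influence_graph_gap_graph
        selected_subset[OF influence_graph_gap_graph is_policy_greedy]] influence_graph_gap_graph
    unfolding influence_graph_def by (blast intro: finite_subset)
  ultimately have "card ({..<N} - inactive \<phi> k) \<le> f_spread gap_graph (selected gap_graph greedy \<phi>) \<phi>"
    unfolding f_spread_def by (rule card_mono[rotated])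
  then show ?thesis
    using inactive_subset[of \<phi> k] by (simp add: card_Diff_subset)
qed

section \<open>Potential argument for the greedy policy\<close>

lemma map_pmf_card_live:
  assumes "X \<in> blocks" "j < k"
  shows "map_pmf (\<lambda>\<phi>. card {v\<in>X. \<phi> (seed X j, v)}) (realization_pmf gap_graph) =
    binomial_pmf (card X) p"
proof -
  let ?A = "{seed X j} \<times> X"
  have A: "?A \<subseteq> edges gap_graph" "finite ?A"
    using assms by (auto simp: seed_edge_iff finite_block)
  have card: "card {e\<in>?A. f e} = card {v\<in>X. f (seed X j, v)}" for f
    by (rule bij_betw_same_card[of snd]) (auto simp: bij_betw_def inj_on_def image_iff)
  have "binomial_pmf (card X) p =
      map_pmf (\<lambda>f. card {e\<in>?A. f e}) (Pi_pmf ?A False (\<lambda>_. bernoulli_pmf p))"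
    using A p_pos p_less_1 by (intro binomial_pmf_altdef') (auto simp: card_cartesian_product)
  also have "Pi_pmf ?A False (\<lambda>_. bernoulli_pmf p) =
      map_pmf (\<lambda>f e. if e \<in> ?A then f e else False) (realization_pmf gap_graph)"
    unfolding realization_pmf_gap_graph by (rule Pi_pmf_subset[OF finite_edges_gap_graph A(1)])
  finally show ?thesis
    by (simp add: map_pmf_comp card cong: conj_cong)
qed

text \<open>
  With \<open>t\<close> steps left and \<open>s\<close> inactive targets, the expected final number of active targets should be
  about \<open>N - s + min s (t * d * p)\<close>. The function \<open>lower\<close> replaces the minimum by the quadratic minorant
  \<open>s - d - (s - t * d * p)\<^sup>2 / (4 * d)\<close>, whose expected change only involves the variance of a binomial
  distribution; the last term compensates for that variance.
\<close>

definition lower :: "nat \<Rightarrow> nat \<Rightarrow> real" where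
  "lower t s = real N - real d - (real s - real t * real d * p)\<^sup>2 / (4 * real d)
     - p * (1 - p) * real t / 4"

text \<open>With fewer than \<open>d\<close> inactive targets no full block is left and the gain is
  no longer binomial with \<open>d\<close> trials. The current number of active targets, which never
  decreases, then replaces \<open>lower\<close>.\<close>

definition potential :: "nat \<Rightarrow> nat \<Rightarrow> real" where
  "potential t s = (if s < d then real N - real s else lower t s)"

lemma lower_le_potential: "lower t s \<le> potential t s"
proof -
  have "0 \<le> (real s - real t * real d * p)\<^sup>2 / (4 * real d)" "0 \<le> p * (1 - p) * real t / 4"
    using p_pos p_less_1 by auto
  then have "lower t s \<le> real N - real d" unfolding lower_def by linarith
  then show ?thesis by (auto simp: potential_def)
qed

lemma potential_0_le: "potential 0 s \<le> real N - real s"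
proof -
  \<comment> \<open>At \<open>t = 0\<close> the quadratic minorant touches the line at
    \<open>s = 2 * d\<close>; this fixes the constants \<open>d\<close> and \<open>4 * d\<close> in
    \<open>lower\<close>.\<close>
  have "real s - real d - (real s)\<^sup>2 / (4 * real d) = - ((real s - 2 * real d)\<^sup>2 / (4 * real d))"
    using d_pos by (simp add: field_simps power2_eq_square)
  also have "\<dots> \<le> 0" by simp
  finally show ?thesis by (simp add: potential_def lower_def)
qed

text \<open>The mean gain \<open>d * p\<close> matches the change of \<open>t * d * p\<close>. What
  remains is the variance \<open>d * p * (1 - p)\<close> over \<open>4 * d\<close>, exactly the
  compensation per step in \<open>lower\<close>.\<close>

lemma lower_step:
  assumes "d \<le> s"
  shows "measure_pmf.expectation (binomial_pmf d p) (\<lambda>i. lower t (s - i)) = lower (Suc t) s"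
proof -
  let ?c = "real s - real (Suc t) * real d * p"
  let ?b = "real N - real d - p * (1 - p) * real t / 4"
  have p: "p \<in> {0..1}" using p_pos p_less_1 by auto
  have "measure_pmf.expectation (binomial_pmf d p) (\<lambda>i. lower t (s - i)) =
      measure_pmf.expectation (binomial_pmf d p)
        (\<lambda>i. ?b - (?c - (real i - real d * p))\<^sup>2 / (4 * real d))"
  proof (intro integral_cong_AE)
    show "AE i in measure_pmf (binomial_pmf d p). lower t (s - i) =
        ?b - (?c - (real i - real d * p))\<^sup>2 / (4 * real d)"
      using assms p set_pmf_binomial_eq[of p d]
      by (auto simp: AE_measure_pmf_iff lower_def of_nat_diff algebra_simps split: if_splits)
  qed auto
  also have "\<dots> = ?b - (?c\<^sup>2 + real d * p * (1 - p)) / (4 * real d)"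
    using p by (simp add: binomial_pmf_variance)
  also have "\<dots> = lower (Suc t) s"
    using d_pos by (simp add: lower_def field_simps)
  finally show ?thesis .
qed

text \<open>Below \<open>d\<close> the claim holds for every realization. Otherwise
  \<open>pick I\<close> has exactly \<open>d\<close> elements, \<open>lower\<close> is preserved in
  expectation, and \<open>potential\<close> dominates it.\<close>

lemma potential_step:
  assumes I: "I \<subseteq> {..<N}" and j: "j < k"
  shows "potential (Suc t) (card I) \<le> measure_pmf.expectation (realization_pmf gap_graph)
    (\<lambda>\<phi>. potential t (card (I - {v\<in>pick I. \<phi> (seed (pick I) j, v)})))"
    (is "_ \<le> measure_pmf.expectation ?P (\<lambda>\<phi>. potential t (card (?J \<phi>)))")
proof -
  have fin: "finite I" using I finite_subset by blast
  show ?thesis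
  proof (cases "card I < d")
    case True
    have "potential (Suc t) (card I) \<le> potential t (card (?J \<phi>))" for \<phi>
      using True card_mono[OF fin, of "?J \<phi>"] by (auto simp: potential_def)
    then show ?thesis
      by (intro measure_pmf.integral_ge_const) auto
  next
    case False
    have "potential (Suc t) (card I) = measure_pmf.expectation (binomial_pmf d p)
        (\<lambda>i. lower t (card I - i))"
      using False by (simp add: potential_def lower_step)
    also have "binomial_pmf d p =
        map_pmf (\<lambda>\<phi>. card {v\<in>pick I. \<phi> (seed (pick I) j, v)}) ?P"
      using map_pmf_card_live[OF pick_in_blocks[OF I] j] pick(2)[OF fin] False by simp
    also have "measure_pmf.expectation \<dots> (\<lambda>i. lower t (card I - i)) =
        measure_pmf.expectation ?P (\<lambda>\<phi>. lower t (card (?J \<phi>)))"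
    proof -
      have "card (?J \<phi>) = card I - card {v\<in>pick I. \<phi> (seed (pick I) j, v)}" for \<phi>
        using pick(1)[OF fin] fin by (intro card_Diff_subset) (auto intro: finite_subset)
      then show ?thesis by simp
    qed
    also have "\<dots> \<le> measure_pmf.expectation ?P (\<lambda>\<phi>. potential t (card (?J \<phi>)))"
      by (intro integral_mono lower_le_potential) auto
    finally show ?thesis .
  qed
qed

text \<open>The submartingale property: \<open>inactive \<phi> j\<close> does not see the edges of
  copy \<open>j\<close>, so these can be resampled and \<open>potential_step\<close> applied with
  \<open>inactive \<phi> j\<close> held fixed.\<close>

lemma expectation_potential_mono:
  assumes j: "j < k"
  shows "measure_pmf.expectation (realization_pmf gap_graph)
      (\<lambda>\<phi>. potential (Suc t) (card (inactive \<phi> j))) \<le>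
    measure_pmf.expectation (realization_pmf gap_graph)
      (\<lambda>\<phi>. potential t (card (inactive \<phi> (Suc j))))"
proof -
  let ?P = "realization_pmf gap_graph"
  \<comment> \<open>All edges that step \<open>j\<close> might reveal, whichever block is picked;
    this set does not depend on the realization.\<close>
  define B where "B = (\<Union>X\<in>blocks. {seed X j} \<times> X)"
  define mix where "mix \<phi> \<phi>' = (\<lambda>e. if e \<in> B then \<phi>' e else \<phi> e)" for \<phi> \<phi>' :: "nat realization"
  have B: "B \<subseteq> edges gap_graph"
    using j by (auto simp: B_def seed_edge_iff)
  have inactive_mix: "inactive (mix \<phi> \<phi>') j = inactive \<phi> j" for \<phi> \<phi>'
    by (rule inactive_cong) (auto simp: mix_def B_def seed_eq_iff finite_block)
  have mix: "mix \<phi> \<phi>' (seed X j, v) = \<phi>' (seed X j, v)" if "X \<in> blocks" "v \<in> X" for \<phi> \<phi>' X v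
    using that by (auto simp: mix_def B_def)
  have J: "inactive (mix \<phi> \<phi>') (Suc j) = inactive \<phi> j -
      {v\<in>pick (inactive \<phi> j). \<phi>' (seed (pick (inactive \<phi> j)) j, v)}" for \<phi> \<phi>'
    using mix[OF pick_inactive_in_blocks[of \<phi> j]] by (auto simp: inactive_mix)
  have "measure_pmf.expectation ?P (\<lambda>\<phi>. potential (Suc t) (card (inactive \<phi> j))) \<le>
      measure_pmf.expectation ?P (\<lambda>\<phi>.
        measure_pmf.expectation ?P (\<lambda>\<phi>'. potential t (card (inactive (mix \<phi> \<phi>') (Suc j)))))"
    unfolding J by (intro integral_mono potential_step inactive_subset j) auto
  also have "\<dots> = measure_pmf.expectation ?P (\<lambda>\<phi>. potential t (card (inactive \<phi> (Suc j))))"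
    unfolding mix_def realization_pmf_gap_graph
    by (rule expectation_Pi_pmf_resample[symmetric, OF finite_edges_gap_graph B])
       (use finite_set_realization_pmf[OF influence_graph_gap_graph] in
          \<open>simp add: realization_pmf_gap_graph\<close>)
  finally show ?thesis .
qed

text \<open>The hypothesis makes the square in \<open>lower k N\<close> vanish; the potential then
  carries this value from the start of the run to its end.\<close>

lemma OPT_A_gap_graph_ge:
  assumes "real k * real d * p = real N"
  shows "real N - real d - p * (1 - p) * real k / 4 \<le> OPT_A gap_graph k"
proof -
  let ?P = "realization_pmf gap_graph"
  let ?E = "\<lambda>j. measure_pmf.expectation ?P (\<lambda>\<phi>. potential (k - j) (card (inactive \<phi> j)))"
  have mono: "?E 0 \<le> ?E j" if "j \<le> k" for j
    using that
  proof (induction j)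
    case (Suc j)
    then have "?E j \<le> ?E (Suc j)"
      using expectation_potential_mono[of j "k - Suc j"] by (simp add: Suc_diff_Suc del: inactive.simps)
    with Suc show ?case by simp
  qed simp
  have "real N - real d - p * (1 - p) * real k / 4 = lower k N"
    using assms by (simp add: lower_def)
  also have "\<dots> \<le> ?E 0"
    using lower_le_potential by simp
  also have "\<dots> \<le> ?E k" by (rule mono) simp
  also have "\<dots> \<le> adaptive_spread gap_graph greedy"
    unfolding adaptive_spread_def
    using order_trans[OF potential_0_le f_spread_greedy_ge] by (intro integral_mono) auto
  also have "\<dots> \<le> OPT_A gap_graph k"
    unfolding OPT_A_def using greedy_in_policies
    by (intro Max_ge finite_OPT_A_set influence_graph_gap_graph) auto
  finally show ?thesis .
qed

end

section \<open>Choice of parameters and passage to the limit\<close>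

lemma adaptivity_gap_ge:
  assumes m: "2 \<le> m"
  defines "p \<equiv> 1 / real m"
  shows "\<exists>(G :: nat igraph) k. influence_graph G \<and> 1 \<le> k \<and>
    (real m ^ 3 - real m ^ 2 - p * (1 - p) * real m ^ 2 / 4) /
      (real m ^ 2 + real m ^ 3 * (1 - (1 - p) ^ m)) \<le> OPT_A G k / OPT_N G k"
proof -
  have p: "0 < p" "p < 1" using m by (auto simp: p_def)
  have one: "1 \<le> m ^ 2" using m by (simp add: Suc_le_eq)
  interpret gap_instance "m ^ 3" "m ^ 2" "m ^ 2" p
    by unfold_locales (use p one in auto)
  have "real (m ^ 2) * real (m ^ 2) * p = real (m ^ 3)"
    using m by (simp add: p_def power2_eq_square power3_eq_cube)
  from OPT_A_gap_graph_ge[OF this]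
  have A: "real m ^ 3 - real m ^ 2 - p * (1 - p) * real m ^ 2 / 4 \<le> OPT_A gap_graph (m ^ 2)"
    by simp
  \<comment> \<open>Here \<open>r = m\<close>, since
    \<open>m ^ 2 * m ^ 2 = m * m ^ 3\<close>.\<close>
  have "OPT_N gap_graph (m ^ 2) \<le> real (m ^ 2) + real (m ^ 3) * (1 - (1 - p) ^ m)"
    by (rule OPT_N_gap_graph_le) (simp add: power2_eq_square power3_eq_cube)
  then have N: "OPT_N gap_graph (m ^ 2) \<le> real m ^ 2 + real m ^ 3 * (1 - (1 - p) ^ m)"
    by simp
  \<comment> \<open>Comparing the quotients needs a nonnegative \<open>OPT_A\<close>; its lower
    bound is nonnegative because \<open>m \<ge> 2\<close>.\<close>
  have "p * (1 - p) * real m ^ 2 / 4 \<le> 1 * real m ^ 2 / 4"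
    using p by (intro divide_right_mono mult_right_mono mult_le_one) auto
  moreover have "2 * real m ^ 2 \<le> real m ^ 3"
    using m by (simp add: power2_eq_square power3_eq_cube mult_right_mono)
  ultimately have "0 \<le> real m ^ 3 - real m ^ 2 - p * (1 - p) * real m ^ 2 / 4"
    using zero_le_power2[of "real m"] by linarith
  with A N OPT_N_ge_1[OF influence_graph_gap_graph one]
  have "(real m ^ 3 - real m ^ 2 - p * (1 - p) * real m ^ 2 / 4) /
      (real m ^ 2 + real m ^ 3 * (1 - (1 - p) ^ m)) \<le> OPT_A gap_graph (m ^ 2) / OPT_N gap_graph (m ^ 2)"
    by (intro frac_le) auto
  with influence_graph_gap_graph one show ?thesis by blast
qed

theorem theorem2:
  shows "(SUP (G, k) \<in> {(G :: nat igraph, k). influence_graph G \<and> 1 \<le> k}.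
            ereal (OPT_A G k / OPT_N G k)) \<ge> ereal (exp 1 / (exp 1 - 1))"
    (is "?S \<ge> _")
proof -
  define a :: "nat \<Rightarrow> real" where "a m = (real m ^ 3 - real m ^ 2
      - 1 / real m * (1 - 1 / real m) * real m ^ 2 / 4) /
      (real m ^ 2 + real m ^ 3 * (1 - (1 - 1 / real m) ^ m))" for m
  \<comment> \<open>After division by \<open>m ^ 3\<close> the numerator tends to 1, and
    \<open>(1 - 1 / m) ^ m\<close> tends to \<open>exp (- 1)\<close>.\<close>
  have "a \<longlonglongrightarrow> 1 / (1 - exp (- 1))"
    unfolding a_def by (real_asymp simp: inverse_eq_divide)
  also have "1 / (1 - exp (- 1)) = exp 1 / (exp 1 - (1 :: real))"
    by (simp add: exp_minus field_simps)
  finally have "(\<lambda>m. ereal (a m)) \<longlonglongrightarrow> ereal (exp 1 / (exp 1 - 1))"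
    by simp
  moreover have "\<forall>\<^sub>F m in sequentially. ereal (a m) \<le> ?S"
    using eventually_ge_at_top[of 2]
  proof eventually_elim
    case (elim m)
    from adaptivity_gap_ge[OF elim] obtain G :: "nat igraph" and k
      where G: "influence_graph G" "1 \<le> k" "a m \<le> OPT_A G k / OPT_N G k"
      unfolding a_def by blast
    then show ?case by (intro SUP_upper2[of "(G, k)"]) auto
  qed
  ultimately show ?thesis
    by (intro tendsto_upperbound) auto
qed

end
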